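(* Let $W_{\rm act}$ be the total number of forward Bernoulli calls made by the early-stopped likelihood-coin posterior sampler with common order $n$, exact scalar range stopping, and candidate termination at the first auxiliary event equal to one. Then \[ \mathbb E W_{\rm act}=\gamma e^{a_\sigma b_n^{\mathrm{tot}}(y)}\int_{\mathbb X}\bar\tau_n^{\mathrm{tot}}(q)\,\frac{1-e^{-a_\sigma[b_n^{\mathrm{tot}}(y)+Q_y(q)]}}{b_n^{\mathrm{tot}}(y)+Q_y(q)}\,\mu_0(\mathrm dq), \] where the quotient is read as its limiting value $a_\sigma$ if its denominator vanishes.
   Context: Setting. $(\mathbb X,\mathcal X)$ is a measurable space with prior probability measure $\mu_0$; $p_1,\dots,p_J:\mathbb X\to[0,1]$ are measurable forward observables; $y=(y_1,\dots,y_J)\in[0,1]^J$ is the data; the errors are independent Gaussian with common variance $\sigma^2$, $\sigma>0$; $a_\sigma=(2\sigma^2)^{-1}$; $\gamma>0$; $n\ge2$ is an integer. A $p$-coin is a Bernoulli($p$) variable; all coins are independent. Bernstein quantities. For $y\in[0,1]$ and $0\le k\le n$: $\beta_{k,n}(y)=y^2-\frac{2yk}{n}+\frac{k(k-1)}{n(n-1)}$, $b_n(y)=-\min_{0\le k\le n}\beta_{k,n}(y)$, $c_{k,n}(y)=\beta_{k,n}(y)+b_n(y)$, $C_n(y)=\max\{1,\max_k c_{k,n}(y)\}$ (which equals $1$ for $y\in[0,1]$), $\widetilde c_{k,n}(y)=c_{k,n}(y)/C_n(y)$. Put $Q_y(q)=\sum_{j=1}^J[p_j(q)-y_j]^2$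 and $b_n^{\mathrm{tot}}(y)=\sum_{j=1}^J b_n(y_j)$. Range-stopped Bernstein event with success probability $p$ and datum $y$: draw $V\sim\operatorname{Unif}(0,1)$ and reveal independent $p$-coins one at a time. After $s\in\{0,\dots,n\}$ coins with $k$ successes, put $\ell=n-s$; stop with output $1$ if $V<\min_{i=k,\ldots,k+\ell}\widetilde c_{i,n}(y)$, and stop with output $0$ if $V\ge\max_{i=k,\ldots,k+\ell}\widetilde c_{i,n}(y)$; otherwise reveal another coin. Let $\tau_{n,y}(p)$ be the number of $p$-coins revealed, $\bar\tau_{n,y}(p)=\mathbb E\tau_{n,y}(p)$, and $\bar\tau_n^{\mathrm{tot}}(q)=\sum_{j=1}^J\bar\tau_{n,y_j}(p_j(q))$. Sampler. Draw $M_\gamma\sim\operatorname{Poisson}(\gamma e^{a_\sigma b_n^{\mathrm{tot}}(y)})$ and candidates $Q_i\stackrel{\rm iid}{\sim}\mu_0$, $i=1,\dots,M_\gamma$. For each candidate independently draw $R\sim\operatorname{Poisson}\bigl(a_\sigma\sum_{j}C_n(y_j)\bigr)$ and process up to $R$ auxiliary events in sequence: for each, independently draw a component label $j$ with probability $C_n(y_j)/\sum_{l}C_n(y_l)$ (i.e. $1/J$), and generate an independent range-stopped Bernstein event with success probability $p_j(Q_i)$ and datum $y_j$. If an event equals $1$, discard the candidate and terminate its remaining tests. If no event equals $1$, retain the candidate. A forward Bernoulli call is one revealed $p_j(Q_i)$-coin. *)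

theory Defs
  imports "HOL-Probability.Probability"
begin

definition bern_beta :: "nat \<Rightarrow> nat \<Rightarrow> real \<Rightarrow> real" where
  "bern_beta n k y = y^2 - 2 * y * real k / real n
     + (real k * (real k - 1)) / (real n * (real n - 1))"

definition bern_b :: "nat \<Rightarrow> real \<Rightarrow> real" where
  "bern_b n y = - Min ((\<lambda>k. bern_beta n k y) ` {0..n})"

definition bern_c :: "nat \<Rightarrow> nat \<Rightarrow> real \<Rightarrow> real" where
  "bern_c n k y = bern_beta n k y + bern_b n y"

definition bern_C :: "nat \<Rightarrow> real \<Rightarrow> real" where
  "bern_C n y = max 1 (Max ((\<lambda>k. bern_c n k y) ` {0..n}))"

definition bern_ctilde :: "nat \<Rightarrow> nat \<Rightarrow> real \<Rightarrow> real" where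
  "bern_ctilde n k y = bern_c n k y / bern_C n y"

definition inv_temp :: "real \<Rightarrow> real" where
  "inv_temp \<sigma> = 1 / (2 * \<sigma>^2)"

definition misfit :: "nat \<Rightarrow> (nat \<Rightarrow> 'x \<Rightarrow> real) \<Rightarrow> (nat \<Rightarrow> real) \<Rightarrow> 'x \<Rightarrow> real" where
  "misfit J p y q = (\<Sum>j\<in>{1..J}. (p j q - y j)^2)"

definition b_tot :: "nat \<Rightarrow> nat \<Rightarrow> (nat \<Rightarrow> real) \<Rightarrow> real" where
  "b_tot n J y = (\<Sum>j\<in>{1..J}. bern_b n (y j))"

text \<open>
  \<open>range_stop n y \<theta> v s k\<close> is the joint law of the output and of the total number of
  revealed coins, for success probability \<open>\<theta>\<close> and threshold variate \<open>v\<close>, when \<open>s\<close> coins with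
  \<open>k\<close> successes have been revealed so far. At \<open>s = n\<close> the range of indices is a singleton, so one
  of the two stopping rules already applies; the disjunct \<open>n \<le> s\<close> never changes the outcome and
  serves termination only.
\<close>

function range_stop :: "nat \<Rightarrow> real \<Rightarrow> real \<Rightarrow> real \<Rightarrow> nat \<Rightarrow> nat \<Rightarrow> (bool \<times> nat) pmf" where
  "range_stop n y \<theta> v s k =
     (if v < Min ((\<lambda>i. bern_ctilde n i y) ` {k..k + (n - s)}) then return_pmf (True, s)
      else if v \<ge> Max ((\<lambda>i. bern_ctilde n i y) ` {k..k + (n - s)}) \<or> n \<le> s
        then return_pmf (False, s)
      else bind_pmf (bernoulli_pmf \<theta>)
             (\<lambda>success. range_stop n y \<theta> v (s + 1) (if success then k + 1 else k)))"
  by pat_completeness auto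
termination
  by (relation "Wellfounded.measure (\<lambda>(n, y, \<theta>, v, s, k). n - s)") auto

declare range_stop.simps [simp del]

definition event_law :: "nat \<Rightarrow> real \<Rightarrow> real \<Rightarrow> (bool \<times> nat) measure" where
  "event_law n y \<theta> =
     do { v \<leftarrow> uniform_measure lborel {0<..<1};
          measure_pmf (range_stop n y \<theta> v 0 0) }"

definition tau_bar :: "nat \<Rightarrow> real \<Rightarrow> real \<Rightarrow> real" where
  "tau_bar n y \<theta> = (\<integral>z. real (snd z) \<partial>event_law n y \<theta>)"

definition tau_tot ::
    "nat \<Rightarrow> nat \<Rightarrow> (nat \<Rightarrow> 'x \<Rightarrow> real) \<Rightarrow> (nat \<Rightarrow> real) \<Rightarrow> 'x \<Rightarrow> real" where
  "tau_tot n J p y q = (\<Sum>j\<in>{1..J}. tau_bar n (y j) (p j q))"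

definition label_pmf :: "nat \<Rightarrow> nat \<Rightarrow> (nat \<Rightarrow> real) \<Rightarrow> nat pmf" where
  "label_pmf n J y =
     embed_pmf (\<lambda>j. if j \<in> {1..J} then bern_C n (y j) / (\<Sum>l\<in>{1..J}. bern_C n (y l)) else 0)"

text \<open>
  The law of (candidate retained?, number of forward calls) when up to \<open>r\<close> auxiliary events are
  processed for the candidate \<open>q\<close>, stopping at the first event equal to one.
\<close>

primrec run_tests ::
    "nat \<Rightarrow> nat \<Rightarrow> (nat \<Rightarrow> 'x \<Rightarrow> real) \<Rightarrow> (nat \<Rightarrow> real) \<Rightarrow> 'x \<Rightarrow> nat \<Rightarrow> (bool \<times> nat) measure" where
  "run_tests n J p y q 0 = return (count_space UNIV) (True, 0)"
| "run_tests n J p y q (Suc r) =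
     do { j \<leftarrow> measure_pmf (label_pmf n J y);
          (one, t) \<leftarrow> event_law n (y j) (p j q);
          (if one then return (count_space UNIV) (False, t)
           else do { (keep, w) \<leftarrow> run_tests n J p y q r;
                     return (count_space UNIV) (keep, t + w) }) }"

definition candidate_law ::
    "nat \<Rightarrow> nat \<Rightarrow> (nat \<Rightarrow> 'x \<Rightarrow> real) \<Rightarrow> (nat \<Rightarrow> real) \<Rightarrow> real \<Rightarrow> 'x \<Rightarrow> (bool \<times> nat) measure" where
  "candidate_law n J p y \<sigma> q =
     do { r \<leftarrow> measure_pmf (poisson_pmf (inv_temp \<sigma> * (\<Sum>j\<in>{1..J}. bern_C n (y j))));
          run_tests n J p y q r }"

definition record_law ::
    "'x measure \<Rightarrow> nat \<Rightarrow> nat \<Rightarrow> (nat \<Rightarrow> 'x \<Rightarrow> real) \<Rightarrow> (nat \<Rightarrow> real) \<Rightarrow> real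
       \<Rightarrow> ('x \<times> bool \<times> nat) measure" where
  "record_law \<mu>0 n J p y \<sigma> =
     do { q \<leftarrow> \<mu>0;
          z \<leftarrow> candidate_law n J p y \<sigma> q;
          return (\<mu>0 \<Otimes>\<^sub>M count_space UNIV) (q, z) }"

text \<open>
  A sample point \<open>(m, \<omega>)\<close> consists of the number \<open>m\<close> of candidates and of an i.i.d. sequence
  \<open>\<omega>\<close> of records (candidate, retained?, forward calls spent on it). Only the records
  \<open>\<omega> 1, \<dots>, \<omega> m\<close> belong to the run of the sampler; indexing by all of \<open>nat\<close> provides one
  probability space for every value of \<open>m\<close>.
\<close>

definition posterior_sampler ::
    "'x measure \<Rightarrow> nat \<Rightarrow> nat \<Rightarrow> (nat \<Rightarrow> 'x \<Rightarrow> real) \<Rightarrow> (nat \<Rightarrow> real) \<Rightarrow> real \<Rightarrow> real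
       \<Rightarrow> (nat \<times> (nat \<Rightarrow> 'x \<times> bool \<times> nat)) measure" where
  "posterior_sampler \<mu>0 n J p y \<sigma> \<gamma> =
     measure_pmf (poisson_pmf (\<gamma> * exp (inv_temp \<sigma> * b_tot n J y)))
       \<Otimes>\<^sub>M (\<Pi>\<^sub>M i\<in>UNIV. record_law \<mu>0 n J p y \<sigma>)"

definition W_act :: "nat \<times> (nat \<Rightarrow> 'x \<times> bool \<times> nat) \<Rightarrow> nat" where
  "W_act = (\<lambda>(m, \<omega>). \<Sum>i\<in>{1..m}. snd (snd (\<omega> i)))"

end

theory Submission
  imports Defs
begin

text \<open>
  Everything reduces to one auxiliary event. The vector
  \<open>bern_beta n k y\<close>, \<open>k = 0, \<dots>, n\<close>, consists of the degree-\<open>n\<close> Bernstein coefficients of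
  \<open>\<theta> \<mapsto> (\<theta> - y)\<^sup>2\<close>, so averaging it over a binomial(\<open>n\<close>, \<open>\<theta>\<close>) number of successes returns
  \<open>(\<theta> - y)\<^sup>2\<close> exactly. Two coefficients differ by at most one for \<open>y \<in> [0, 1]\<close>; hence the shifted
  coefficients \<open>bern_c\<close> lie in \<open>[0, 1]\<close>, the normalisation \<open>bern_C\<close> is one (\<open>bern_C_eq_1\<close>), and
  the component label is uniform. Range stopping reveals a coin only as long as the comparison of
  \<open>V\<close> with the coefficient at the final success count is open, so it has the same
  output as revealing all \<open>n\<close> coins: an event equals one with probability
  \<open>(\<theta> - y)\<^sup>2 + bern_b n y\<close> (\<open>prob_event_one\<close>).

  For a candidate \<open>q\<close> write \<open>D = b_tot + misfit\<close> and \<open>T = tau_tot\<close>. An event with uniform label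
  costs \<open>T / J\<close> coins on average and equals one with probability \<open>D / J\<close>. The \<open>(i + 1)\<close>-st event is
  processed iff the first \<open>i\<close> events were zero, and that is independent of its own cost.
  Thus \<open>r\<close> available events cost \<open>T / J * (\<Sum>i<r. (1 - D / J) ^ i)\<close> on average
  (\<open>nn_integral_run_tests\<close>). Averaging the geometric sum over \<open>r \<sim> Poisson(a J)\<close> with \<open>a = inv_temp \<sigma>\<close>
  gives \<open>T * (1 - exp (- a D)) / D\<close>, with value \<open>T * a\<close> at \<open>D = 0\<close> (\<open>nn_integral_candidate_law\<close>).

  Finally, the number of candidates is independent of the i.i.d. sequence of records, so the mean
  total cost is the Poisson mean times the \<open>\<mu>0\<close>-average of the cost of one candidate
  (\<open>nn_integral_poisson_iid_sum\<close>). All means are computed as integrals of nonnegative functions,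
  with values in \<open>[0, \<infinity>]\<close>; the result is finite, and this yields integrability.
\<close>

section \<open>Bernstein coefficients of the squared misfit\<close>

text \<open>
  The difference is affine in \<open>y\<close>, so only the end points matter. At \<open>y = 0\<close> the coefficient is
  \<open>k (k - 1) / (n (n - 1))\<close>, at \<open>y = 1\<close> it is the same expression in \<open>n - k\<close>; both lie in \<open>[0, 1]\<close>.
\<close>

lemma bern_beta_diff_le_1:
  assumes "0 \<le> y" "y \<le> 1" "i \<le> n" "k \<le> n" "2 \<le> n"
  shows "bern_beta n k y - bern_beta n i y \<le> 1"
proof -
  define N I K where "N = real n" and "I = real i" and "K = real k"
  have N: "2 \<le> N" "I \<le> N" "K \<le> N" "0 \<le> I" "0 \<le> K"
    using assms by (auto simp: N_def I_def K_def)
  \<comment> \<open>This fails for real \<open>x\<close> between 0 and 1, so integrality of the indices is needed here.\<close>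
  have falling: "0 \<le> x * (x - 1)" if "x \<in> {I, K, N - I, N - K}" for x
  proof -
    have "N - I = real (n - i)" "N - K = real (n - k)"
      using assms by (auto simp: N_def I_def K_def of_nat_diff)
    then have "x \<in> real ` {i, k, n - i, n - k}"
      using that by (auto simp: I_def K_def)
    then obtain m where "x = real m" by blast
    then show ?thesis by (cases m) auto
  qed
  have shrink: "x * (x - 1) \<le> N * (N - 1)" if "0 \<le> x" "x \<le> N" for x
  proof (cases "x \<le> 1")
    case True
    then have "x * (x - 1) \<le> 0" using that by (simp add: mult_nonneg_nonpos)
    also have "0 \<le> N * (N - 1)" using N by simp
    finally show ?thesis .
  next
    case False
    then show ?thesis using that by (intro mult_mono) auto
  qed
  have pos: "0 < N * (N - 1)" using N by simp
  \<comment> \<open>The convex combination of the values at the two end points.\<close>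
  have eq: "bern_beta n k y - bern_beta n i y =
      (1 - y) * ((K * (K - 1) - I * (I - 1)) / (N * (N - 1)))
      + y * (((N - K) * (N - K - 1) - (N - I) * (N - I - 1)) / (N * (N - 1)))"
    using N unfolding bern_beta_def N_def[symmetric] I_def[symmetric] K_def[symmetric]
    by (simp add: divide_simps) (simp add: algebra_simps power2_eq_square)
  have "(K * (K - 1) - I * (I - 1)) / (N * (N - 1)) \<le> 1"
    using falling[of I] shrink[of K] N pos by (subst pos_divide_le_eq) auto
  moreover have "((N - K) * (N - K - 1) - (N - I) * (N - I - 1)) / (N * (N - 1)) \<le> 1"
    using falling[of "N - I"] shrink[of "N - K"] N pos by (subst pos_divide_le_eq) auto
  ultimately show ?thesis
    unfolding eq using assms(1,2) by (intro convex_bound_le) auto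
qed

lemma bern_c_nonneg:
  assumes "k \<le> n"
  shows "0 \<le> bern_c n k y"
proof -
  have "Min ((\<lambda>k. bern_beta n k y) ` {0..n}) \<le> bern_beta n k y"
    using assms by (intro Min_le) auto
  then show ?thesis unfolding bern_c_def bern_b_def by linarith
qed

lemma bern_c_le_1:
  assumes "0 \<le> y" "y \<le> 1" "k \<le> n" "2 \<le> n"
  shows "bern_c n k y \<le> 1"
proof -
  have "Min ((\<lambda>k. bern_beta n k y) ` {0..n}) \<in> (\<lambda>k. bern_beta n k y) ` {0..n}"
    by (intro Min_in) auto
  then obtain i where "Min ((\<lambda>k. bern_beta n k y) ` {0..n}) = bern_beta n i y" "i \<in> {0..n}"
    by (rule imageE)
  then show ?thesis
    using bern_beta_diff_le_1[of y i n k] assms unfolding bern_c_def bern_b_def by simp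
qed

lemma bern_C_eq_1:
  assumes "0 \<le> y" "y \<le> 1" "2 \<le> n"
  shows "bern_C n y = 1"
  using bern_c_le_1[OF assms(1,2) _ assms(3)] by (auto simp: bern_C_def max_def intro!: antisym)

lemma bern_ctilde_eq:
  assumes "0 \<le> y" "y \<le> 1" "2 \<le> n"
  shows "bern_ctilde n k y = bern_c n k y"
  using bern_C_eq_1[OF assms] by (simp add: bern_ctilde_def)

section \<open>The output of a range-stopped event\<close>

text \<open>
  The mean of \<open>f (k + K)\<close> for a binomial(\<open>l\<close>, \<open>\<theta>\<close>) variable \<open>K\<close>. The recursion conditions on the
  first coin, as \<open>range_stop\<close> does, so that the two can be compared by induction.
\<close>

primrec bernoulli_avg :: "real \<Rightarrow> nat \<Rightarrow> (nat \<Rightarrow> real) \<Rightarrow> nat \<Rightarrow> real" where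
  "bernoulli_avg \<theta> 0 f k = f k"
| "bernoulli_avg \<theta> (Suc l) f k =
     \<theta> * bernoulli_avg \<theta> l f (Suc k) + (1 - \<theta>) * bernoulli_avg \<theta> l f k"

lemma bernoulli_avg_cong:
  "(\<And>i. k \<le> i \<Longrightarrow> i \<le> k + l \<Longrightarrow> f i = g i) \<Longrightarrow> bernoulli_avg \<theta> l f k = bernoulli_avg \<theta> l g k"
proof (induction l arbitrary: k)
  case (Suc l)
  have "bernoulli_avg \<theta> l f (Suc k) = bernoulli_avg \<theta> l g (Suc k)"
    "bernoulli_avg \<theta> l f k = bernoulli_avg \<theta> l g k"
    by (rule Suc.IH; use Suc.prems in auto)+
  then show ?case by simp
qed auto

lemma bernoulli_avg_const: "bernoulli_avg \<theta> l (\<lambda>_. c) k = c"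
  by (induction l arbitrary: k) (auto simp: algebra_simps)

text \<open>
  The first two factorial moments of a binomial variable shifted by \<open>k\<close>, in the basis \<open>1, i, i (i - 1)\<close> in
  which \<open>bern_beta\<close> is written.
\<close>

lemma bernoulli_avg_quadratic:
  "bernoulli_avg \<theta> l (\<lambda>i. a + b * real i + c * (real i * (real i - 1))) k =
     a + b * (real k + real l * \<theta>)
     + c * (real k * (real k - 1) + 2 * real k * real l * \<theta> + real l * (real l - 1) * \<theta>^2)"
proof (induction l arbitrary: k)
  case (Suc l)
  show ?case
    unfolding bernoulli_avg.simps Suc.IH by (simp add: algebra_simps power2_eq_square)
qed simp

lemma bernoulli_avg_bern_c:
  assumes "2 \<le> n"
  shows "bernoulli_avg \<theta> n (\<lambda>k. bern_c n k y) 0 = (\<theta> - y)^2 + bern_b n y"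
proof -
  have "(\<lambda>k. bern_c n k y) = (\<lambda>k. (y^2 + bern_b n y) + (- 2 * y / real n) * real k
      + 1 / (real n * (real n - 1)) * (real k * (real k - 1)))"
    by (auto simp: bern_c_def bern_beta_def)
  then have "bernoulli_avg \<theta> n (\<lambda>k. bern_c n k y) 0 =
      (y^2 + bern_b n y) + (- 2 * y / real n) * (real n * \<theta>)
      + 1 / (real n * (real n - 1)) * (real n * (real n - 1) * \<theta>^2)"
    by (simp only: bernoulli_avg_quadratic) simp
  then show ?thesis
    using assms by (simp add: power2_diff)
qed

text \<open>
  A finite convex combination commutes with the integral over the threshold variate.
\<close>

lemma bernoulli_avg_integral:
  assumes "\<And>i. integrable M (\<lambda>v. F v i)"
  shows "integrable M (\<lambda>v. bernoulli_avg \<theta> l (F v) k)"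
    and "(\<integral>v. bernoulli_avg \<theta> l (F v) k \<partial>M) = bernoulli_avg \<theta> l (\<lambda>i. \<integral>v. F v i \<partial>M) k"
proof (induction l arbitrary: k)
  case 0 case 1 then show ?case using assms by simp
next
  case 0 case 2 then show ?case by simp
next
  case (Suc l) case 1 then show ?case using Suc.IH(1) by simp
next
  case (Suc l) case 2 then show ?case using Suc.IH by simp
qed

lemma pmf_bind_bernoulli:
  "pmf (bind_pmf (bernoulli_pmf \<theta>) f) z =
     pmf (bernoulli_pmf \<theta>) True * pmf (f True) z + pmf (bernoulli_pmf \<theta>) False * pmf (f False) z"
  by (subst pmf_bind, subst integral_measure_pmf[of UNIV]) (auto simp: UNIV_bool)

text \<open>
  Stopping early does not change the output: if \<open>v\<close> lies below all coefficients that can still be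
  reached, or above all of them, then the comparison with the coefficient at the final success count
  is already decided.
\<close>

lemma prob_range_stop_one:
  assumes "0 \<le> \<theta>" "\<theta> \<le> 1" "s \<le> n"
  shows "pmf (map_pmf fst (range_stop n y \<theta> v s k)) True =
    bernoulli_avg \<theta> (n - s) (\<lambda>i. indicator {..<bern_ctilde n i y} v) k"
  using assms(3)
proof (induction "n - s" arbitrary: s k)
  case 0
  then show ?case
    by (subst range_stop.simps) (auto simp: map_pmf_def bind_return_pmf pmf_return)
next
  case (Suc l)
  let ?c = "\<lambda>i. bern_ctilde n i y" and ?f = "\<lambda>i. indicator {..<bern_ctilde n i y} v :: real"
  let ?A = "?c ` {k..k + (n - s)}"
  consider (one) "v < Min ?A" | (zero) "\<not> v < Min ?A" "Max ?A \<le> v"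
    | (flip) "\<not> v < Min ?A" "\<not> Max ?A \<le> v" by blast
  then show ?case
  proof cases
    case one
    have "bernoulli_avg \<theta> (n - s) ?f k = bernoulli_avg \<theta> (n - s) (\<lambda>_. 1) k"
      using one by (intro bernoulli_avg_cong) auto
    with one show ?thesis
      by (subst range_stop.simps) (simp add: bernoulli_avg_const map_pmf_def bind_return_pmf)
  next
    case zero
    have "bernoulli_avg \<theta> (n - s) ?f k = bernoulli_avg \<theta> (n - s) (\<lambda>_. 0) k"
      using zero by (intro bernoulli_avg_cong) (auto simp: indicator_def not_less)
    with zero show ?thesis
      by (subst range_stop.simps) (simp add: bernoulli_avg_const map_pmf_def bind_return_pmf)
  next
    case flip
    have "\<not> n \<le> s" using Suc by simp
    then have "range_stop n y \<theta> v s k = bind_pmf (bernoulli_pmf \<theta>)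
        (\<lambda>b. range_stop n y \<theta> v (s + 1) (if b then k + 1 else k))"
      using flip by (subst range_stop.simps) (simp only: if_False simp_thms)
    then have "pmf (map_pmf fst (range_stop n y \<theta> v s k)) True =
        \<theta> * pmf (map_pmf fst (range_stop n y \<theta> v (s + 1) (k + 1))) True +
        (1 - \<theta>) * pmf (map_pmf fst (range_stop n y \<theta> v (s + 1) k)) True"
      using assms by (simp add: map_bind_pmf pmf_bind_bernoulli)
    moreover have "n - s = Suc (n - Suc s)" using Suc by simp
    ultimately show ?thesis
      using Suc.hyps(1)[of "s + 1"] Suc(2,3) by simp
  qed
qed

lemma range_stop_coins_le:
  "z \<in> set_pmf (range_stop n y \<theta> v s k) \<Longrightarrow> s \<le> n \<Longrightarrow> snd z \<le> n"
proof (induction "n - s" arbitrary: s k z)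
  case 0
  then show ?case
    by (subst (asm) range_stop.simps) (auto split: if_splits)
next
  case (Suc l)
  have later: "snd z \<le> n" if "z \<in> set_pmf (range_stop n y \<theta> v (s + 1) k')" for k'
    using Suc(1)[of "s + 1"] Suc(2,4) that by simp
  have "snd z = s \<or> (\<exists>k'. z \<in> set_pmf (range_stop n y \<theta> v (s + 1) k'))"
    using Suc(3)
    by (subst (asm) range_stop.simps)
       (simp only: if_distrib[of set_pmf] set_return_pmf set_bind_pmf; auto split: if_splits)
  then show ?case using later Suc.prems by auto
qed

section \<open>Measurability of the event law\<close>

text \<open>
  The counterpart of \<open>measurable_pair_measure_countable1\<close> for a countable second factor.
\<close>

lemma measurable_pair_measure_countable2:
  assumes "countable A" "\<And>a. a \<in> A \<Longrightarrow> (\<lambda>x. f (x, a)) \<in> M \<rightarrow>\<^sub>M K"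
  shows "f \<in> M \<Otimes>\<^sub>M count_space A \<rightarrow>\<^sub>M K"
proof -
  have "(\<lambda>x. f (fst x, snd x)) \<in> M \<Otimes>\<^sub>M count_space A \<rightarrow>\<^sub>M K"
    using assms
    by (intro measurable_compose_countable'[where f = "\<lambda>a x. f (fst x, a)" and g = snd and I = A]
          measurable_compose[OF measurable_fst]) auto
  then show ?thesis by simp
qed

text \<open>
  Integrals over a bind in the Giry monad are iterated integrals only for measurable kernels. On
  countable target spaces this amounts to measurability of the single point probabilities.
\<close>

lemma measurable_measure_pmf_countable:
  fixes f :: "'a \<Rightarrow> 'b::countable pmf"
  assumes [measurable]: "\<And>z. (\<lambda>x. pmf (f x) z) \<in> borel_measurable M"
  shows "(\<lambda>x. measure_pmf (f x)) \<in> M \<rightarrow>\<^sub>M prob_algebra (count_space UNIV)"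
proof (intro measurable_prob_algebraI measurable_subprob_algebra)
  fix A :: "'b set"
  interpret sigma_finite_measure "count_space (UNIV :: 'b set)"
    by (rule sigma_finite_measure_count_space)
  have "emeasure (measure_pmf (f x)) A = (\<integral>\<^sup>+z. ennreal (pmf (f x) z) * indicator A z \<partial>count_space UNIV)" for x
    by (subst nn_integral_measure_pmf[symmetric]) simp
  moreover have "(\<lambda>(x, z). ennreal (pmf (f x) z) * indicator A z) \<in>
      borel_measurable (M \<Otimes>\<^sub>M count_space UNIV)"
    by (rule measurable_pair_measure_countable2) auto
  ultimately show "(\<lambda>x. emeasure (measure_pmf (f x)) A) \<in> borel_measurable M"
    by (simp add: borel_measurable_nn_integral)
qed (auto intro: measure_pmf.prob_space_axioms prob_space_imp_subprob_space)

lemma pmf_bernoulli_clamp: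
  "pmf (bernoulli_pmf \<theta>) b = (if b then min 1 (max 0 \<theta>) else 1 - min 1 (max 0 \<theta>))"
  by (simp add: bernoulli_pmf.rep_eq)

text \<open>
  The clamp of \<open>\<theta>\<close> to \<open>[0, 1]\<close>, which \<open>bernoulli_pmf\<close> performs, makes the recursion valid, and its
  solution measurable, on the whole real line.
\<close>

lemma pmf_range_stop:
  fixes n s k :: nat and y v :: real
  defines "A \<equiv> (\<lambda>i. bern_ctilde n i y) ` {k..k + (n - s)}"
  shows "pmf (range_stop n y \<theta> v s k) z =
    (if v < Min A then pmf (return_pmf (True, s)) z
     else if Max A \<le> v \<or> n \<le> s then pmf (return_pmf (False, s)) z
     else min 1 (max 0 \<theta>) * pmf (range_stop n y \<theta> v (s + 1) (k + 1)) z
       + (1 - min 1 (max 0 \<theta>)) * pmf (range_stop n y \<theta> v (s + 1) k) z)"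
proof -
  consider "v < Min A" | "\<not> v < Min A" "Max A \<le> v \<or> n \<le> s"
    | "\<not> v < Min A" "\<not> (Max A \<le> v \<or> n \<le> s)" by blast
  then show ?thesis
    unfolding A_def
    by cases (subst range_stop.simps,
      simp only: pmf_bind_bernoulli pmf_bernoulli_clamp if_True if_False simp_thms)+
qed

lemma measurable_pmf_range_stop:
  "(\<lambda>(\<theta>, v). pmf (range_stop n y \<theta> v s k) z) \<in> borel_measurable (borel \<Otimes>\<^sub>M borel)"
proof (induction "n - s" arbitrary: s k)
  case 0
  then have "n \<le> s" by simp
  then show ?case
    by (subst pmf_range_stop, simp only: split_beta' simp_thms if_True, measurable)
next
  case (Suc l)
  have [measurable]: "(\<lambda>x. pmf (range_stop n y (fst x) (snd x) (s + 1) k) z)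
      \<in> borel_measurable (borel \<Otimes>\<^sub>M borel)" for k
    using Suc(1)[of "s + 1" k] Suc(2) by (simp add: split_beta')
  show ?case
    by (subst pmf_range_stop, simp only: split_beta', measurable)
qed

abbreviation unif01 :: "real measure" where
  "unif01 \<equiv> uniform_measure lborel {0<..<1}"

lemma prob_space_unif01: "prob_space unif01"
  by (rule prob_space_uniform_measure) auto

lemma measurable_event_law [measurable]:
  "event_law n y \<in> borel \<rightarrow>\<^sub>M prob_algebra (count_space UNIV)"
proof -
  have "(\<lambda>x. measure_pmf (range_stop n y (fst x) (snd x) 0 0))
      \<in> borel \<Otimes>\<^sub>M borel \<rightarrow>\<^sub>M prob_algebra (count_space UNIV)"
    using measurable_pmf_range_stop[of n y 0 0]
    by (intro measurable_measure_pmf_countable) (simp add: split_beta')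
  moreover have "sets (borel \<Otimes>\<^sub>M unif01) = sets (borel \<Otimes>\<^sub>M borel)"
    by (rule sets_pair_measure_cong) auto
  ultimately have "(\<lambda>x. measure_pmf (range_stop n y (fst x) (snd x) 0 0))
      \<in> borel \<Otimes>\<^sub>M unif01 \<rightarrow>\<^sub>M prob_algebra (count_space UNIV)"
    by (simp cong: measurable_cong_sets)
  then show ?thesis
    unfolding event_law_def
    by (intro measurable_bind_prob_space2[where N = unif01] measurable_const)
       (auto simp: space_prob_algebra prob_space_unif01 split_beta')
qed

section \<open>Success probability and cost of one event\<close>

lemma
  shows prob_space_event_law: "prob_space (event_law n y \<theta>)"
    and sets_event_law [measurable_cong, simp]: "sets (event_law n y \<theta>) = sets (count_space UNIV)"
    and space_event_law [simp]: "space (event_law n y \<theta>) = UNIV"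
proof -
  have "event_law n y \<theta> \<in> space (prob_algebra (count_space UNIV))"
    using measurable_event_law[of n y] by (rule measurable_space) simp
  then show "prob_space (event_law n y \<theta>)"
    and *: "sets (event_law n y \<theta>) = sets (count_space UNIV)"
    by (auto simp: space_prob_algebra)
  show "space (event_law n y \<theta>) = UNIV" using sets_eq_imp_space_eq[OF *] by simp
qed

lemma nn_integral_event_law:
  "(\<integral>\<^sup>+z. f z \<partial>event_law n y \<theta>) = (\<integral>\<^sup>+v. \<integral>\<^sup>+z. f z \<partial>range_stop n y \<theta> v 0 0 \<partial>unif01)"
proof -
  have "(\<lambda>v. (\<theta>, v)) \<in> unif01 \<rightarrow>\<^sub>M borel \<Otimes>\<^sub>M borel" by measurable
  then have "(\<lambda>v. measure_pmf (range_stop n y \<theta> v 0 0)) \<in> unif01 \<rightarrow>\<^sub>M prob_algebra (count_space UNIV)"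
    by (intro measurable_measure_pmf_countable)
       (drule measurable_compose[OF _ measurable_pmf_range_stop[of n y 0 0]], simp)
  then show ?thesis
    unfolding event_law_def
    by (intro nn_integral_bind[where B = "count_space UNIV"] measurable_prob_algebraD) auto
qed

lemma integral_unif01_threshold:
  assumes "0 \<le> c" "c \<le> 1"
  shows "(\<integral>v. indicat_real {..<c} v \<partial>unif01) = c"
proof -
  have "{0<..<1} \<inter> {..<c} = {0<..<c}" using assms by auto
  then show ?thesis
    using assms by (simp add: measure_uniform_measure)
qed

text \<open>
  For a fixed threshold the event is one with the binomial average of the indicators
  \<open>v < bern_ctilde n i y\<close>. Integration over the uniform threshold turns each indicator into the
  coefficient itself, because the coefficients lie in \<open>[0, 1]\<close>, and the binomial average of the
  Bernstein coefficients is the polynomial.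
\<close>

lemma prob_event_one:
  assumes "0 \<le> \<theta>" "\<theta> \<le> 1" "0 \<le> y" "y \<le> 1" "2 \<le> n"
  shows "measure (event_law n y \<theta>) {z. fst z} = (\<theta> - y)^2 + bern_b n y"
proof -
  interpret U: prob_space unif01 by (rule prob_space_unif01)
  interpret E: prob_space "event_law n y \<theta>" by (rule prob_space_event_law)
  define F where "F v i = indicat_real {..<bern_ctilde n i y} v" for v i
  have F: "integrable unif01 (\<lambda>v. F v i)" for i
    unfolding F_def by (intro U.integrable_const_bound[where B = 1]) auto
  have one: "measure_pmf.prob (range_stop n y \<theta> v 0 0) {z. fst z} = bernoulli_avg \<theta> n (F v) 0" for v
  proof -
    have "(fst -` {True} :: (bool \<times> nat) set) = {z. fst z}"
      and "F v = (\<lambda>i. indicat_real {..<bern_ctilde n i y} v)"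
      by (auto simp: F_def)
    then show ?thesis
      using prob_range_stop_one[of \<theta> 0 n y v 0] assms(1,2) by (simp add: pmf_map)
  qed
  have nonneg: "0 \<le> bernoulli_avg \<theta> n (F v) 0" for v
    unfolding one[symmetric] by simp
  have "emeasure (event_law n y \<theta>) {z. fst z} = (\<integral>\<^sup>+z. indicator {z. fst z} z \<partial>event_law n y \<theta>)"
    by simp
  also have "\<dots> = (\<integral>\<^sup>+v. ennreal (bernoulli_avg \<theta> n (F v) 0) \<partial>unif01)"
    unfolding nn_integral_event_law by (simp add: measure_pmf.emeasure_eq_measure one)
  also have "\<dots> = ennreal (\<integral>v. bernoulli_avg \<theta> n (F v) 0 \<partial>unif01)"
    using nonneg by (intro nn_integral_eq_integral bernoulli_avg_integral F) auto
  finally have "measure (event_law n y \<theta>) {z. fst z} = (\<integral>v. bernoulli_avg \<theta> n (F v) 0 \<partial>unif01)"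
    using nonneg by (simp add: E.emeasure_eq_measure)
  also have "\<dots> = bernoulli_avg \<theta> n (\<lambda>i. \<integral>v. F v i \<partial>unif01) 0"
    by (rule bernoulli_avg_integral(2)[OF F])
  also have "\<dots> = bernoulli_avg \<theta> n (\<lambda>i. bern_c n i y) 0"
  proof (rule bernoulli_avg_cong)
    fix i assume "i \<le> 0 + n"
    then show "(\<integral>v. F v i \<partial>unif01) = bern_c n i y"
      unfolding F_def bern_ctilde_eq[OF assms(3-5)]
      using assms bern_c_nonneg[of i n y] bern_c_le_1[of y i n]
      by (intro integral_unif01_threshold) auto
  qed
  also have "\<dots> = (\<theta> - y)^2 + bern_b n y"
    by (rule bernoulli_avg_bern_c) fact
  finally show ?thesis .
qed

lemma nn_integral_event_coins_le:
  "(\<integral>\<^sup>+z. ennreal (real (snd z)) \<partial>event_law n y \<theta>) \<le> ennreal (real n)"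
proof -
  interpret U: prob_space unif01 by (rule prob_space_unif01)
  have "(\<integral>\<^sup>+z. ennreal (real (snd z)) \<partial>range_stop n y \<theta> v 0 0) \<le> ennreal (real n)" for v
  proof -
    have "(\<integral>\<^sup>+z. ennreal (real (snd z)) \<partial>range_stop n y \<theta> v 0 0) \<le> (\<integral>\<^sup>+z. ennreal (real n) \<partial>range_stop n y \<theta> v 0 0)"
      using range_stop_coins_le[of _ n y \<theta> v 0 0]
      by (intro nn_integral_mono_AE) (auto simp: AE_measure_pmf_iff intro!: ennreal_leI)
    then show ?thesis by simp
  qed
  then have "(\<integral>\<^sup>+z. ennreal (real (snd z)) \<partial>event_law n y \<theta>) \<le> (\<integral>\<^sup>+v. ennreal (real n) \<partial>unif01)"
    unfolding nn_integral_event_law by (intro nn_integral_mono) auto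
  then show ?thesis by (simp add: U.emeasure_space_1)
qed

lemma tau_bar_nonneg: "0 \<le> tau_bar n y \<theta>"
  unfolding tau_bar_def by simp

lemma ennreal_tau_bar:
  "(\<integral>\<^sup>+z. ennreal (real (snd z)) \<partial>event_law n y \<theta>) = ennreal (tau_bar n y \<theta>)"
proof -
  have "tau_bar n y \<theta> = enn2real (\<integral>\<^sup>+z. ennreal (real (snd z)) \<partial>event_law n y \<theta>)"
    unfolding tau_bar_def
    by (intro integral_eq_nn_integral) (auto simp: measurable_cong_sets[OF sets_event_law refl])
  moreover have "(\<integral>\<^sup>+z. ennreal (real (snd z)) \<partial>event_law n y \<theta>) < \<top>"
    using nn_integral_event_coins_le[of n y \<theta>] by (rule le_less_trans) simp
  ultimately show ?thesis by simp
qed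

lemma tau_bar_le: "tau_bar n y \<theta> \<le> real n"
  using nn_integral_event_coins_le[of n y \<theta>] by (simp add: ennreal_tau_bar)

lemma tau_tot_bounds: "0 \<le> tau_tot n J p y q" "tau_tot n J p y q \<le> real J * real n"
proof -
  show "0 \<le> tau_tot n J p y q" unfolding tau_tot_def by (intro sum_nonneg tau_bar_nonneg)
  have "tau_tot n J p y q \<le> (\<Sum>j\<in>{1..J}. real n)"
    unfolding tau_tot_def by (intro sum_mono tau_bar_le)
  then show "tau_tot n J p y q \<le> real J * real n" by simp
qed

text \<open>
  All weights \<open>bern_C\<close> are equal to one. This is why the cost formula involves the plain sum of the
  component costs.
\<close>

lemma label_pmf_uniform:
  assumes "\<And>j. j \<in> {1..J} \<Longrightarrow> 0 \<le> y j \<and> y j \<le> 1" "1 \<le> J" "2 \<le> n"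
  shows "label_pmf n J y = pmf_of_set {1..J}"
proof -
  have C: "bern_C n (y j) = 1" if "j \<in> {1..J}" for j
    using assms that by (intro bern_C_eq_1) auto
  then have *: "(\<lambda>j. if j \<in> {1..J} then bern_C n (y j) / (\<Sum>l\<in>{1..J}. bern_C n (y l)) else 0)
      = pmf (pmf_of_set {1..J})"
    using assms(2) by (auto simp: fun_eq_iff indicator_def)
  show ?thesis
    unfolding label_pmf_def * by (rule type_definition.Rep_inverse[OF td_pmf_embed_pmf])
qed

section \<open>Sequential tests of one candidate\<close>

lemma bind_in_prob_algebra:
  assumes "A \<in> space (prob_algebra M)" "B \<in> M \<rightarrow>\<^sub>M prob_algebra N"
  shows "A \<bind> B \<in> space (prob_algebra N)"
  using prob_space_bind'[OF assms] sets_bind'[OF assms] by (simp add: space_prob_algebra)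

text \<open>
  What \<open>run_tests\<close> does after one event \<open>(one, t)\<close>, where \<open>N\<close> is the law of the remaining tests.
\<close>

definition continue_tests :: "(bool \<times> nat) measure \<Rightarrow> bool \<times> nat \<Rightarrow> (bool \<times> nat) measure" where
  "continue_tests N = (\<lambda>(one, t).
     (if one then return (count_space UNIV) (False, t)
      else do { (keep, w) \<leftarrow> N; return (count_space UNIV) (keep, t + w) }))"

lemma run_tests_Suc:
  "run_tests n J p y q (Suc r) =
     do { j \<leftarrow> measure_pmf (label_pmf n J y);
          z \<leftarrow> event_law n (y j) (p j q);
          continue_tests (run_tests n J p y q r) z }"
  by (simp add: continue_tests_def)

lemma return_in_prob_algebra:
  "x \<in> space M \<Longrightarrow> return M x \<in> space (prob_algebra M)"
  by (simp add: space_prob_algebra prob_space_return)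

lemma measure_pmf_in_prob_algebra: "measure_pmf p \<in> space (prob_algebra (count_space UNIV))"
  by (simp add: space_prob_algebra measure_pmf.prob_space_axioms)

lemma event_law_in_prob_algebra: "event_law n y \<theta> \<in> space (prob_algebra (count_space UNIV))"
  by (simp add: space_prob_algebra prob_space_event_law)

lemma continue_tests_in_prob_algebra:
  assumes "N \<in> space (prob_algebra (count_space UNIV))"
  shows "continue_tests N z \<in> space (prob_algebra (count_space UNIV))"
  using assms unfolding continue_tests_def
  by (cases z) (auto intro!: bind_in_prob_algebra return_in_prob_algebra)

lemma nn_integral_continue_tests:
  assumes "N \<in> space (prob_algebra (count_space UNIV))"
  shows "(\<integral>\<^sup>+u. ennreal (real (snd u)) \<partial>continue_tests N z) =
    ennreal (real (snd z)) + (\<integral>\<^sup>+u. ennreal (real (snd u)) \<partial>N) * indicator {z. \<not> fst z} z"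
proof -
  interpret N: prob_space N using assms by (simp add: space_prob_algebra)
  have sets_N: "sets N = sets (count_space UNIV)" using assms by (simp add: space_prob_algebra)
  obtain one t where z: "z = (one, t)" by (cases z)
  have "(\<integral>\<^sup>+u. ennreal (real (snd u)) \<partial>(N \<bind> (\<lambda>(keep, w). return (count_space UNIV) (keep, t + w))))
      = (\<integral>\<^sup>+x. ennreal (real t) + ennreal (real (snd x)) \<partial>N)"
    by (subst nn_integral_bind[where B = "count_space UNIV"])
       (auto simp: measurable_cong_sets[OF sets_N refl] split_beta' nn_integral_return ennreal_plus
         space_subprob_algebra prob_space_imp_subprob_space prob_space_return)
  also have "\<dots> = ennreal (real t) + (\<integral>\<^sup>+u. ennreal (real (snd u)) \<partial>N)"
    by (subst nn_integral_add) (auto simp: measurable_cong_sets[OF sets_N refl] N.emeasure_space_1)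
  finally show ?thesis
    by (cases one) (simp_all add: z continue_tests_def nn_integral_return)
qed

lemma run_tests_in_prob_algebra:
  "run_tests n J p y q r \<in> space (prob_algebra (count_space UNIV))"
proof (induction r)
  case (Suc r)
  then show ?case
    unfolding run_tests_Suc
    by (auto intro!: bind_in_prob_algebra[where M = "count_space UNIV"] continue_tests_in_prob_algebra
        measure_pmf_in_prob_algebra event_law_in_prob_algebra)
qed (simp add: return_in_prob_algebra)

text \<open>
  Only the components \<open>p j\<close> with a label of positive probability matter.
\<close>

lemma run_tests_cong:
  assumes "\<And>j. j \<in> {1..J} \<Longrightarrow> p j q = p' j q'" "set_pmf (label_pmf n J y) \<subseteq> {1..J}"
  shows "run_tests n J p y q r = run_tests n J p' y q' r"
proof (induction r)
  case (Suc r)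
  have sub: "event_law n (y j) (p j q) \<bind> continue_tests (run_tests n J p y q r)
      \<in> space (subprob_algebra (count_space UNIV))" for j p q
  proof -
    have "event_law n (y j) (p j q) \<bind> continue_tests (run_tests n J p y q r)
        \<in> space (prob_algebra (count_space UNIV))"
      by (auto intro!: bind_in_prob_algebra[where M = "count_space UNIV"] continue_tests_in_prob_algebra
          event_law_in_prob_algebra run_tests_in_prob_algebra)
    then show ?thesis
      by (auto simp: space_prob_algebra space_subprob_algebra prob_space_imp_subprob_space)
  qed
  show ?case
    unfolding run_tests_Suc
  proof (rule bind_measure_pmf_cong[where N = "count_space UNIV"])
    fix j assume "j \<in> set_pmf (label_pmf n J y)"
    then show "event_law n (y j) (p j q) \<bind> continue_tests (run_tests n J p y q r) =
        event_law n (y j) (p' j q') \<bind> continue_tests (run_tests n J p' y q' r)"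
      using assms Suc.IH by auto
  qed (rule sub)+
qed simp

lemma measurable_continue_tests:
  assumes [measurable]: "K \<in> M \<rightarrow>\<^sub>M prob_algebra (count_space UNIV)"
  shows "(\<lambda>x. continue_tests (K (fst x)) (snd x)) \<in> M \<Otimes>\<^sub>M count_space UNIV \<rightarrow>\<^sub>M prob_algebra (count_space UNIV)"
proof (rule measurable_pair_measure_countable2)
  fix z :: "bool \<times> nat"
  have "(\<lambda>q. K q \<bind> (\<lambda>(keep, w). return (count_space UNIV) (keep, snd z + w)))
      \<in> M \<rightarrow>\<^sub>M prob_algebra (count_space UNIV)"
    by (rule measurable_bind_prob_space[where N = "count_space UNIV"])
       (auto simp: return_in_prob_algebra)
  then show "(\<lambda>x. continue_tests (K (fst (x, z))) (snd (x, z))) \<in> M \<rightarrow>\<^sub>M prob_algebra (count_space UNIV)"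
    by (cases z) (auto simp: continue_tests_def return_in_prob_algebra)
qed auto

text \<open>
  The observables are measurable for labels in \<open>{1..J}\<close> only, whereas the kernel that is bound to the
  label has to be measurable for every natural number; hence the other observables are
  first replaced by zero.
\<close>

lemma measurable_run_tests:
  assumes "\<And>j. j \<in> {1..J} \<Longrightarrow> p j \<in> borel_measurable M"
    and "set_pmf (label_pmf n J y) \<subseteq> {1..J}"
  shows "(\<lambda>q. run_tests n J p y q r) \<in> M \<rightarrow>\<^sub>M prob_algebra (count_space UNIV)"
proof -
  define p' where "p' j = (if j \<in> {1..J} then p j else (\<lambda>_. 0))" for j
  have [measurable]: "p' j \<in> borel_measurable M" for j
    using assms(1) by (simp add: p'_def)
  have "(\<lambda>q. run_tests n J p' y q r) \<in> M \<rightarrow>\<^sub>M prob_algebra (count_space UNIV)"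
  proof (induction r)
    case (Suc r)
    have step: "(\<lambda>q. event_law n (y j) (p' j q) \<bind> continue_tests (run_tests n J p' y q r))
        \<in> M \<rightarrow>\<^sub>M prob_algebra (count_space UNIV)" for j
      by (rule measurable_bind_prob_space2[where N = "count_space UNIV"])
         (use measurable_continue_tests[OF Suc.IH] in \<open>simp_all add: split_beta'\<close>)
    show ?case
      unfolding run_tests_Suc
    proof (rule measurable_bind_prob_space2[where N = "count_space UNIV"])
      show "(\<lambda>(q, j). event_law n (y j) (p' j q) \<bind> continue_tests (run_tests n J p' y q r))
          \<in> M \<Otimes>\<^sub>M count_space UNIV \<rightarrow>\<^sub>M prob_algebra (count_space UNIV)"
        by (rule measurable_pair_measure_countable2) (auto intro: step)
    qed (simp add: measure_pmf_in_prob_algebra)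
  qed (simp add: return_in_prob_algebra)
  also have "(\<lambda>q. run_tests n J p' y q r) = (\<lambda>q. run_tests n J p y q r)"
    using assms(2) by (intro ext run_tests_cong) (auto simp: p'_def)
  finally show ?thesis .
qed

text \<open>
  The current event is always paid for; the remaining tests, which do not depend on it, are paid for
  iff it equals zero.
\<close>

lemma nn_integral_run_tests_Suc:
  defines "W \<equiv> \<lambda>N. \<integral>\<^sup>+u. ennreal (real (snd u)) \<partial>(N :: (bool \<times> nat) measure)"
  shows "W (run_tests n J p y q (Suc r)) =
    (\<integral>\<^sup>+j. ennreal (tau_bar n (y j) (p j q))
      + W (run_tests n J p y q r) * ennreal (1 - measure (event_law n (y j) (p j q)) {z. fst z})
      \<partial>label_pmf n J y)"
proof -
  note tests = run_tests_in_prob_algebra[of n J p y q r]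
  note tests_sub = continue_tests_in_prob_algebra[OF tests]
  have cont: "continue_tests (run_tests n J p y q r)
      \<in> event_law n (y j) (p j q) \<rightarrow>\<^sub>M prob_algebra (count_space UNIV)" for j
    using tests_sub by (simp add: measurable_cong_sets[OF sets_event_law refl])
  have W_event: "W (event_law n (y j) (p j q) \<bind> continue_tests (run_tests n J p y q r)) =
      ennreal (tau_bar n (y j) (p j q))
      + W (run_tests n J p y q r) * ennreal (1 - measure (event_law n (y j) (p j q)) {z. fst z})"
    for j
  proof -
    interpret E: prob_space "event_law n (y j) (p j q)" by (rule prob_space_event_law)
    have compl: "measure (event_law n (y j) (p j q)) {z. \<not> fst z}
        = 1 - measure (event_law n (y j) (p j q)) {z. fst z}"
      using E.prob_compl[of "{z. fst z}"] by (simp add: set_diff_eq)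
    have "W (event_law n (y j) (p j q) \<bind> continue_tests (run_tests n J p y q r)) =
        (\<integral>\<^sup>+z. ennreal (real (snd z)) + W (run_tests n J p y q r) * indicator {z. \<not> fst z} z
          \<partial>event_law n (y j) (p j q))"
      unfolding W_def
      by (subst nn_integral_bind[OF _ measurable_prob_algebraD[OF cont]])
         (simp_all add: nn_integral_continue_tests[OF tests])
    also have "\<dots> = ennreal (tau_bar n (y j) (p j q))
        + W (run_tests n J p y q r) * emeasure (event_law n (y j) (p j q)) {z. \<not> fst z}"
      by (subst nn_integral_add)
         (auto simp: measurable_cong_sets[OF sets_event_law refl] ennreal_tau_bar nn_integral_cmult_indicator)
    finally show ?thesis by (simp add: E.emeasure_eq_measure compl)
  qed
  have "(\<lambda>j. event_law n (y j) (p j q) \<bind> continue_tests (run_tests n J p y q r))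
      \<in> measure_pmf (label_pmf n J y) \<rightarrow>\<^sub>M prob_algebra (count_space UNIV)"
    using tests_sub
    by (auto intro!: bind_in_prob_algebra[where M = "count_space UNIV"] event_law_in_prob_algebra)
  then show ?thesis
    unfolding run_tests_Suc W_event[symmetric] unfolding W_def
    by (intro nn_integral_bind[where B = "count_space UNIV"] measurable_prob_algebraD) auto
qed

section \<open>Poisson averages of geometric sums\<close>

text \<open>
  The mean number of events processed when a Poisson(\<open>\<rho>\<close>) number of them is available, each of them
  is one with probability \<open>\<pi>\<close>, and processing ends at the first one.
\<close>

definition expected_trials :: "real \<Rightarrow> real \<Rightarrow> real" where
  "expected_trials \<rho> \<pi> = (if \<pi> = 0 then \<rho> else (1 - exp (- \<rho> * \<pi>)) / \<pi>)"

lemma expected_trials_nonneg: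
  assumes "0 \<le> \<rho>" "0 \<le> \<pi>"
  shows "0 \<le> expected_trials \<rho> \<pi>"
  using assms by (auto simp: expected_trials_def)

lemma expected_trials_le:
  assumes "0 \<le> \<rho>" "0 \<le> \<pi>"
  shows "expected_trials \<rho> \<pi> \<le> \<rho>"
proof (cases "\<pi> = 0")
  case False
  have "1 - exp (- \<rho> * \<pi>) \<le> \<rho> * \<pi>" using exp_ge_add_one_self[of "- \<rho> * \<pi>"] by simp
  then show ?thesis using False assms by (simp add: expected_trials_def divide_le_eq)
qed (simp add: expected_trials_def)

text \<open>
  For \<open>\<pi> \<noteq> 0\<close> the inner sum is \<open>(1 - (1 - \<pi>) ^ r) / \<pi>\<close>, and the Poisson generating function at
  \<open>1 - \<pi>\<close> is \<open>exp (- \<rho> * \<pi>)\<close>; for \<open>\<pi> = 0\<close> the inner sum is \<open>r\<close> and the value is the Poisson mean.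
\<close>

lemma poisson_geometric_sums:
  fixes \<rho> \<pi> :: real
  shows "(\<lambda>r. \<rho> ^ r / fact r * exp (- \<rho>) * (\<Sum>i<r. (1 - \<pi>) ^ i)) sums expected_trials \<rho> \<pi>"
proof (cases "\<pi> = 0")
  case True
  have "(\<lambda>r. \<rho> * (exp (- \<rho>) * (\<rho> ^ r /\<^sub>R fact r))) sums (\<rho> * (exp (- \<rho>) * exp \<rho>))"
    by (intro sums_mult exp_converges)
  moreover have "\<rho> * (exp (- \<rho>) * (\<rho> ^ r /\<^sub>R fact r)) = \<rho> ^ Suc r / fact (Suc r) * exp (- \<rho>) * real (Suc r)" for r
    by (simp add: field_simps del: of_nat_Suc)
  ultimately have "(\<lambda>r. \<rho> ^ Suc r / fact (Suc r) * exp (- \<rho>) * real (Suc r)) sums \<rho>"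
    by (simp add: exp_minus)
  then have "(\<lambda>r. \<rho> ^ r / fact r * exp (- \<rho>) * real r) sums \<rho>"
    by (subst (asm) sums_Suc_iff) simp
  then show ?thesis using True by (simp add: expected_trials_def)
next
  case False
  have "(\<lambda>r. exp (- \<rho>) / \<pi> * (\<rho> ^ r /\<^sub>R fact r - (\<rho> * (1 - \<pi>)) ^ r /\<^sub>R fact r)) sums
      (exp (- \<rho>) / \<pi> * (exp \<rho> - exp (\<rho> * (1 - \<pi>))))"
    by (intro sums_mult sums_diff exp_converges)
  also have "exp (- \<rho>) / \<pi> * (exp \<rho> - exp (\<rho> * (1 - \<pi>))) = expected_trials \<rho> \<pi>"
    using False by (simp add: expected_trials_def exp_minus exp_diff algebra_simps divide_simps)
  also have "(\<lambda>r. exp (- \<rho>) / \<pi> * (\<rho> ^ r /\<^sub>R fact r - (\<rho> * (1 - \<pi>)) ^ r /\<^sub>R fact r)) =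
      (\<lambda>r. \<rho> ^ r / fact r * exp (- \<rho>) * (\<Sum>i<r. (1 - \<pi>) ^ i))"
  proof
    fix r
    have gp: "(\<Sum>i<r. (1 - \<pi>) ^ i) = (1 - (1 - \<pi>) ^ r) / \<pi>"
      using sum_gp_strict[of "1 - \<pi>" r] False by simp
    show "exp (- \<rho>) / \<pi> * (\<rho> ^ r /\<^sub>R fact r - (\<rho> * (1 - \<pi>)) ^ r /\<^sub>R fact r) =
        \<rho> ^ r / fact r * exp (- \<rho>) * (\<Sum>i<r. (1 - \<pi>) ^ i)"
      unfolding gp power_mult_distrib by (simp add: divide_inverse algebra_simps)
  qed
  finally show ?thesis .
qed

lemma nn_integral_poisson_geometric:
  assumes "0 < \<rho>" "0 \<le> c" "\<pi> \<le> 1"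
  shows "(\<integral>\<^sup>+r. ennreal (c * (\<Sum>i<r. (1 - \<pi>) ^ i)) \<partial>poisson_pmf \<rho>) = ennreal (c * expected_trials \<rho> \<pi>)"
proof -
  have geometric: "0 \<le> (\<Sum>i<r. (1 - \<pi>) ^ i)" for r
    using assms by (intro sum_nonneg) auto
  have "ennreal (\<rho> ^ r / fact r * exp (- \<rho>)) * ennreal (c * (\<Sum>i<r. (1 - \<pi>) ^ i)) =
      ennreal (c * (\<rho> ^ r / fact r * exp (- \<rho>) * (\<Sum>i<r. (1 - \<pi>) ^ i)))" for r
    using assms geometric[of r] by (subst ennreal_mult[symmetric]) (auto simp: mult_ac)
  then have "(\<integral>\<^sup>+r. ennreal (c * (\<Sum>i<r. (1 - \<pi>) ^ i)) \<partial>poisson_pmf \<rho>) =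
      (\<Sum>r. ennreal (c * (\<rho> ^ r / fact r * exp (- \<rho>) * (\<Sum>i<r. (1 - \<pi>) ^ i))))"
    using assms by (simp add: nn_integral_measure_pmf nn_integral_count_space_nat)
  also have "\<dots> = ennreal (c * expected_trials \<rho> \<pi>)"
    using assms geometric
    by (intro suminf_ennreal_eq sums_mult poisson_geometric_sums mult_nonneg_nonneg) auto
  finally show ?thesis .
qed

section \<open>Mean cost of one candidate\<close>

context
  fixes n J :: nat and y :: "nat \<Rightarrow> real"
  assumes J: "1 \<le> J" and n: "2 \<le> n" and y: "\<And>j. j \<in> {1..J} \<Longrightarrow> 0 \<le> y j \<and> y j \<le> 1"
begin

lemma label_pmf_eq: "label_pmf n J y = pmf_of_set {1..J}"
  by (rule label_pmf_uniform[OF y J n])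

text \<open>
  Divided by \<open>J\<close>, this is the success probability of an event with uniform label; hence the
  following bounds.
\<close>

lemma total_potential_eq:
  assumes "\<And>j. j \<in> {1..J} \<Longrightarrow> 0 \<le> p j q \<and> p j q \<le> 1"
  shows "b_tot n J y + misfit J p y q =
    (\<Sum>j\<in>{1..J}. measure (event_law n (y j) (p j q)) {z. fst z})"
  using assms y n by (simp add: b_tot_def misfit_def prob_event_one sum.distrib)

lemma total_potential_bounds:
  assumes "\<And>j. j \<in> {1..J} \<Longrightarrow> 0 \<le> p j q \<and> p j q \<le> 1"
  shows "0 \<le> b_tot n J y + misfit J p y q" "b_tot n J y + misfit J p y q \<le> real J"
proof -
  note D = total_potential_eq[where p = p and q = q, OF assms]
  show "0 \<le> b_tot n J y + misfit J p y q"
    by (subst D) (auto intro: sum_nonneg)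
  have "(\<Sum>j\<in>{1..J}. measure (event_law n (y j) (p j q)) {z. fst z}) \<le> (\<Sum>j\<in>{1..J}. 1)"
    by (intro sum_mono prob_space.prob_le_1 prob_space_event_law)
  then show "b_tot n J y + misfit J p y q \<le> real J" by (subst D) auto
qed

text \<open>
  With \<open>T = tau_tot\<close> the mean costs satisfy \<open>e (Suc r) = T / J + (1 - D / J) * e r\<close> and \<open>e 0 = 0\<close>, a
  recursion solved by a geometric sum.
\<close>

lemma nn_integral_run_tests:
  assumes p: "\<And>j. j \<in> {1..J} \<Longrightarrow> 0 \<le> p j q \<and> p j q \<le> 1"
  defines "D \<equiv> b_tot n J y + misfit J p y q"
  shows "(\<integral>\<^sup>+u. ennreal (real (snd u)) \<partial>run_tests n J p y q r) =
    ennreal (tau_tot n J p y q / real J * (\<Sum>i<r. (1 - D / real J) ^ i))"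
proof (induction r)
  case 0
  then show ?case by (simp add: nn_integral_return)
next
  case (Suc r)
  define T where "T = tau_tot n J p y q"
  define x where "x = 1 - D / real J"
  define e where "e = T / real J * (\<Sum>i<r. x ^ i)"
  have T: "0 \<le> T" unfolding T_def by (rule tau_tot_bounds)
  have x: "0 \<le> x" using total_potential_bounds[where p = p and q = q, OF p] J by (simp add: x_def D_def)
  have e: "0 \<le> e" unfolding e_def using T x by (intro mult_nonneg_nonneg sum_nonneg) auto
  let ?\<pi> = "\<lambda>j. measure (event_law n (y j) (p j q)) {z. fst z}"
  have \<pi>: "?\<pi> j \<le> 1" for j by (intro prob_space.prob_le_1 prob_space_event_law)
  have D: "D = (\<Sum>j\<in>{1..J}. ?\<pi> j)"
    unfolding D_def by (rule total_potential_eq) (rule p)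
  have "(\<integral>\<^sup>+u. ennreal (real (snd u)) \<partial>run_tests n J p y q (Suc r)) =
      (\<integral>\<^sup>+j. ennreal (tau_bar n (y j) (p j q) + e * (1 - ?\<pi> j)) \<partial>pmf_of_set {1..J})"
    unfolding nn_integral_run_tests_Suc Suc.IH label_pmf_eq T_def[symmetric] x_def[symmetric] e_def[symmetric]
    using e \<pi> tau_bar_nonneg by (simp add: ennreal_mult ennreal_plus)
  also have "\<dots> = ennreal ((\<Sum>j\<in>{1..J}. tau_bar n (y j) (p j q) + e * (1 - ?\<pi> j)) / real J)"
  proof -
    have average: "(\<integral>\<^sup>+j. ennreal (t j) \<partial>pmf_of_set {1..J}) = ennreal ((\<Sum>j\<in>{1..J}. t j) / real J)"
      if "\<And>j. 0 \<le> t j" for t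
      using J that
      by (simp add: nn_integral_pmf_of_set sum_ennreal sum_nonneg divide_ennreal ennreal_of_nat_eq_real_of_nat)
    show ?thesis
    proof (rule average)
      show "0 \<le> tau_bar n (y j) (p j q) + e * (1 - ?\<pi> j)" for j
        using e \<pi>[of j] tau_bar_nonneg[of n "y j" "p j q"] by simp
    qed
  qed
  also have "(\<Sum>j\<in>{1..J}. tau_bar n (y j) (p j q) + e * (1 - ?\<pi> j)) = T + e * (real J - D)"
    unfolding D T_def tau_tot_def by (simp add: sum.distrib sum_distrib_left[symmetric] sum_subtractf)
  also have "(T + e * (real J - D)) / real J = T / real J + x * e"
    using J by (simp add: x_def field_simps)
  also have "\<dots> = T / real J * (\<Sum>i<Suc r. x ^ i)"
    unfolding e_def by (subst sum.lessThan_Suc_shift) (simp add: sum_distrib_left algebra_simps)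
  finally show ?case unfolding T_def x_def .
qed

text \<open>
  Mean cost and success probability of an event are \<open>tau_tot / J\<close> and \<open>D / J\<close>, while the Poisson
  rate is \<open>inv_temp \<sigma> * J\<close>, so that the number of components cancels.
\<close>

lemma nn_integral_candidate_law:
  assumes p: "\<And>j. j \<in> {1..J} \<Longrightarrow> 0 \<le> p j q \<and> p j q \<le> 1" and \<sigma>: "0 < \<sigma>"
  defines "D \<equiv> b_tot n J y + misfit J p y q"
  shows "(\<integral>\<^sup>+u. ennreal (real (snd u)) \<partial>candidate_law n J p y \<sigma> q) =
    ennreal (tau_tot n J p y q * expected_trials (inv_temp \<sigma>) D)"
proof -
  have "(\<Sum>j\<in>{1..J}. bern_C n (y j)) = (\<Sum>j\<in>{1..J}. 1)"
    using y n by (intro sum.cong bern_C_eq_1) auto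
  then have rate: "(\<Sum>j\<in>{1..J}. bern_C n (y j)) = real J" by simp
  have a: "0 < inv_temp \<sigma>" using \<sigma> by (simp add: inv_temp_def)
  have "(\<integral>\<^sup>+u. ennreal (real (snd u)) \<partial>candidate_law n J p y \<sigma> q) =
      (\<integral>\<^sup>+r. ennreal (tau_tot n J p y q / real J * (\<Sum>i<r. (1 - D / real J) ^ i))
        \<partial>poisson_pmf (inv_temp \<sigma> * real J))"
    unfolding candidate_law_def rate D_def
    by (simp only: nn_integral_run_tests[where p = p and q = q, OF p, symmetric],
        intro nn_integral_bind[where B = "count_space UNIV"] measurable_prob_algebraD)
       (auto intro!: run_tests_in_prob_algebra)
  also have "\<dots> = ennreal (tau_tot n J p y q / real J * expected_trials (inv_temp \<sigma> * real J) (D / real J))"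
    using a J total_potential_bounds[where p = p and q = q, OF p] tau_tot_bounds[of n J p y q]
    by (intro nn_integral_poisson_geometric) (auto simp: D_def)
  also have "tau_tot n J p y q / real J * expected_trials (inv_temp \<sigma> * real J) (D / real J) =
      tau_tot n J p y q * expected_trials (inv_temp \<sigma>) D"
    using J by (simp add: expected_trials_def)
  finally show ?thesis .
qed

lemma measurable_candidate_law:
  assumes "\<And>j. j \<in> {1..J} \<Longrightarrow> p j \<in> borel_measurable M"
  shows "candidate_law n J p y \<sigma> \<in> M \<rightarrow>\<^sub>M prob_algebra (count_space UNIV)"
  unfolding candidate_law_def
proof (rule measurable_bind_prob_space2[where N = "count_space UNIV"])
  show "(\<lambda>(q, r). run_tests n J p y q r) \<in> M \<Otimes>\<^sub>M count_space UNIV \<rightarrow>\<^sub>M prob_algebra (count_space UNIV)"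
    using J
    by (intro measurable_pair_measure_countable2) (auto intro!: measurable_run_tests assms simp: label_pmf_eq)
qed (simp add: measure_pmf_in_prob_algebra)

end

section \<open>A Poisson number of independent candidates\<close>

lemma nn_integral_poisson_id:
  assumes "0 < \<rho>"
  shows "(\<integral>\<^sup>+m. ennreal (real m) \<partial>poisson_pmf \<rho>) = ennreal \<rho>"
  using nn_integral_poisson_geometric[OF assms, of 1 0] by (simp add: expected_trials_def)

lemma nn_integral_iid_sum:
  assumes "prob_space R" and [measurable]: "f \<in> borel_measurable R"
  shows "(\<integral>\<^sup>+\<omega>. (\<Sum>i\<in>I. f (\<omega> i)) \<partial>(\<Pi>\<^sub>M i\<in>(UNIV :: nat set). R)) = of_nat (card I) * (\<integral>\<^sup>+z. f z \<partial>R)"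
proof -
  have "(\<integral>\<^sup>+\<omega>. f (\<omega> i) \<partial>(\<Pi>\<^sub>M i\<in>(UNIV :: nat set). R)) = (\<integral>\<^sup>+z. f z \<partial>R)" for i
  proof -
    have "(\<integral>\<^sup>+z. f z \<partial>R) = (\<integral>\<^sup>+z. f z \<partial>distr (\<Pi>\<^sub>M i\<in>(UNIV :: nat set). R) R (\<lambda>\<omega>. \<omega> i))"
      using distr_PiM_component[of UNIV "\<lambda>_. R" i] assms(1) by simp
    also have "\<dots> = (\<integral>\<^sup>+\<omega>. f (\<omega> i) \<partial>(\<Pi>\<^sub>M i\<in>(UNIV :: nat set). R))"
      by (intro nn_integral_distr) auto
    finally show ?thesis by simp
  qed
  then show ?thesis by (subst nn_integral_sum) auto
qed

text \<open>
  A form of Wald's identity: the Poisson number of summands is independent of the summands.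
\<close>

lemma nn_integral_poisson_iid_sum:
  assumes R: "prob_space R" and [measurable]: "f \<in> borel_measurable R" and "0 < \<rho>"
  shows "(\<integral>\<^sup>+x. (case x of (m, \<omega>) \<Rightarrow> \<Sum>i\<in>{1..m}. f (\<omega> i)) \<partial>(measure_pmf (poisson_pmf \<rho>) \<Otimes>\<^sub>M (\<Pi>\<^sub>M i\<in>UNIV. R)))
    = ennreal \<rho> * (\<integral>\<^sup>+z. f z \<partial>R)"
proof -
  interpret P: prob_space "\<Pi>\<^sub>M i\<in>(UNIV :: nat set). R" by (intro prob_space_PiM R)
  have "(\<lambda>(m, \<omega>). \<Sum>i\<in>{1..m}. f (\<omega> i)) \<in> borel_measurable (count_space UNIV \<Otimes>\<^sub>M (\<Pi>\<^sub>M i\<in>(UNIV :: nat set). R))"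
    by (rule measurable_pair_measure_countable1) auto
  then have meas: "(\<lambda>(m, \<omega>). \<Sum>i\<in>{1..m}. f (\<omega> i))
      \<in> borel_measurable (measure_pmf (poisson_pmf \<rho>) \<Otimes>\<^sub>M (\<Pi>\<^sub>M i\<in>(UNIV :: nat set). R))"
    by (simp add: measurable_cong_sets[OF sets_pair_measure_cong[OF sets_measure_pmf_count_space refl] refl])
  have "(\<integral>\<^sup>+x. (case x of (m, \<omega>) \<Rightarrow> \<Sum>i\<in>{1..m}. f (\<omega> i)) \<partial>(measure_pmf (poisson_pmf \<rho>) \<Otimes>\<^sub>M (\<Pi>\<^sub>M i\<in>UNIV. R)))
      = (\<integral>\<^sup>+m. of_nat m * (\<integral>\<^sup>+z. f z \<partial>R) \<partial>poisson_pmf \<rho>)"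
    by (subst P.nn_integral_fst[OF meas, symmetric]) (simp add: nn_integral_iid_sum[OF R])
  also have "\<dots> = (\<integral>\<^sup>+m. ennreal (real m) \<partial>poisson_pmf \<rho>) * (\<integral>\<^sup>+z. f z \<partial>R)"
    by (subst nn_integral_multc[symmetric]) (auto simp: ennreal_of_nat_eq_real_of_nat)
  finally show ?thesis using nn_integral_poisson_id[OF \<open>0 < \<rho>\<close>] by simp
qed

theorem theorem3p9:
  fixes \<mu>0 :: "'x measure" and p :: "nat \<Rightarrow> 'x \<Rightarrow> real" and y :: "nat \<Rightarrow> real"
    and J n :: nat and \<sigma> \<gamma> :: real
  assumes "prob_space \<mu>0"
    and "J \<ge> 1"
    and "\<And>j. j \<in> {1..J} \<Longrightarrow> p j \<in> borel_measurable \<mu>0"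
    and "\<And>j q. j \<in> {1..J} \<Longrightarrow> q \<in> space \<mu>0 \<Longrightarrow> 0 \<le> p j q \<and> p j q \<le> 1"
    and "\<And>j. j \<in> {1..J} \<Longrightarrow> 0 \<le> y j \<and> y j \<le> 1"
    and "\<sigma> > 0"
    and "\<gamma> > 0"
    and "n \<ge> 2"
  shows "integrable (posterior_sampler \<mu>0 n J p y \<sigma> \<gamma>) (\<lambda>\<omega>. real (W_act \<omega>)) \<and>
    (\<integral>\<omega>. real (W_act \<omega>) \<partial>posterior_sampler \<mu>0 n J p y \<sigma> \<gamma>) =
      \<gamma> * exp (inv_temp \<sigma> * b_tot n J y) *
      (\<integral>q. tau_tot n J p y q *
          (let D = b_tot n J y + misfit J p y q in
             if D = 0 then inv_temp \<sigma> else (1 - exp (- inv_temp \<sigma> * D)) / D) \<partial>\<mu>0)"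
proof -
  interpret \<mu>0: prob_space \<mu>0 by fact
  note setting = assms(2,8,5)
  \<comment> \<open>The mean cost of the candidate \<open>q\<close>, the mean number of candidates, and the law of one record.\<close>
  define g where "g q = tau_tot n J p y q * expected_trials (inv_temp \<sigma>) (b_tot n J y + misfit J p y q)" for q
  define \<Lambda> where "\<Lambda> = \<gamma> * exp (inv_temp \<sigma> * b_tot n J y)"
  define R where "R = record_law \<mu>0 n J p y \<sigma>"
  have \<Lambda>: "0 < \<Lambda>" using assms by (simp add: \<Lambda>_def)
  have a: "0 \<le> inv_temp \<sigma>" by (simp add: inv_temp_def)
  have g_nonneg: "0 \<le> g q" and g_le: "g q \<le> real J * real n * inv_temp \<sigma>" if "q \<in> space \<mu>0" for q
    unfolding g_def
    using tau_tot_bounds[of n J p y q] total_potential_bounds[OF setting, where p = p and q = q]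
      assms(4) that a by (auto intro!: mult_nonneg_nonneg mult_mono expected_trials_nonneg expected_trials_le)
  have cand [measurable]: "candidate_law n J p y \<sigma> \<in> \<mu>0 \<rightarrow>\<^sub>M prob_algebra (count_space UNIV)"
    by (rule measurable_candidate_law[OF setting assms(3)])
  have cost: "(\<integral>\<^sup>+u. ennreal (real (snd u)) \<partial>candidate_law n J p y \<sigma> q) = ennreal (g q)"
    if "q \<in> space \<mu>0" for q
    unfolding g_def using that assms(4,6) by (intro nn_integral_candidate_law[OF setting]) auto
  \<comment> \<open>Measurability of \<open>g\<close> is inherited from the kernel whose mean it is.\<close>
  have "(\<lambda>q. \<integral>\<^sup>+u. ennreal (real (snd u)) \<partial>candidate_law n J p y \<sigma> q) \<in> borel_measurable \<mu>0"
    by (rule measurable_compose[OF measurable_prob_algebraD[OF cand]]) auto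
  then have "(\<lambda>q. enn2real (\<integral>\<^sup>+u. ennreal (real (snd u)) \<partial>candidate_law n J p y \<sigma> q)) \<in> borel_measurable \<mu>0"
    by simp
  then have g_meas: "g \<in> borel_measurable \<mu>0"
    by (rule subst[OF measurable_cong, rotated]) (simp add: cost g_nonneg)
  have g_int: "integrable \<mu>0 g"
    using g_nonneg g_le g_meas
    by (intro \<mu>0.integrable_const_bound[where B = "real J * real n * inv_temp \<sigma>"] AE_I2) auto
  have "(\<lambda>(q, z). return (\<mu>0 \<Otimes>\<^sub>M count_space UNIV) (q, z))
      \<in> \<mu>0 \<Otimes>\<^sub>M count_space (UNIV :: (bool \<times> nat) set) \<rightarrow>\<^sub>M prob_algebra (\<mu>0 \<Otimes>\<^sub>M count_space UNIV)"
    unfolding case_prod_eta by (rule measurable_return_prob_space)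
  then have kernel: "(\<lambda>q. candidate_law n J p y \<sigma> q \<bind> (\<lambda>z. return (\<mu>0 \<Otimes>\<^sub>M count_space UNIV) (q, z)))
      \<in> \<mu>0 \<rightarrow>\<^sub>M prob_algebra (\<mu>0 \<Otimes>\<^sub>M count_space UNIV)"
    by (rule measurable_bind_prob_space2[OF cand])
  have R_in: "R \<in> space (prob_algebra (\<mu>0 \<Otimes>\<^sub>M count_space UNIV))"
    unfolding R_def record_law_def
    by (rule bind_in_prob_algebra[OF _ kernel]) (simp add: space_prob_algebra \<mu>0.prob_space_axioms)
  then have R_prob: "prob_space R" and R_sets: "sets R = sets (\<mu>0 \<Otimes>\<^sub>M count_space UNIV)"
    by (auto simp: space_prob_algebra)
  have f: "(\<lambda>z. ennreal (real (snd (snd z))))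
      \<in> borel_measurable (\<mu>0 \<Otimes>\<^sub>M count_space (UNIV :: (bool \<times> nat) set))"
    by (rule measurable_compose[OF measurable_snd]) simp
  have f_R: "(\<lambda>z. ennreal (real (snd (snd z)))) \<in> borel_measurable R"
    using f by (simp add: measurable_cong_sets[OF R_sets refl])
  have "(\<integral>\<^sup>+z. ennreal (real (snd (snd z))) \<partial>R) =
      (\<integral>\<^sup>+q. \<integral>\<^sup>+z. ennreal (real (snd (snd z)))
        \<partial>(candidate_law n J p y \<sigma> q \<bind> (\<lambda>z. return (\<mu>0 \<Otimes>\<^sub>M count_space UNIV) (q, z))) \<partial>\<mu>0)"
    unfolding R_def record_law_def by (rule nn_integral_bind[OF f measurable_prob_algebraD[OF kernel]])
  also have "\<dots> = (\<integral>\<^sup>+q. ennreal (g q) \<partial>\<mu>0)"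
  proof (rule nn_integral_cong)
    fix q assume q: "q \<in> space \<mu>0"
    then have law: "candidate_law n J p y \<sigma> q \<in> space (prob_algebra (count_space UNIV))"
      by (rule measurable_space[OF cand])
    then have sets_law: "sets (candidate_law n J p y \<sigma> q) = sets (count_space UNIV)"
      by (simp add: space_prob_algebra)
    have "(\<lambda>z. return (\<mu>0 \<Otimes>\<^sub>M count_space UNIV) (q, z))
        \<in> candidate_law n J p y \<sigma> q \<rightarrow>\<^sub>M prob_algebra (\<mu>0 \<Otimes>\<^sub>M count_space UNIV)"
      using q by (auto simp: measurable_cong_sets[OF sets_law refl] space_pair_measure intro!: return_in_prob_algebra)
    then have "(\<integral>\<^sup>+z. ennreal (real (snd (snd z)))
        \<partial>(candidate_law n J p y \<sigma> q \<bind> (\<lambda>z. return (\<mu>0 \<Otimes>\<^sub>M count_space UNIV) (q, z))))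
        = (\<integral>\<^sup>+z. \<integral>\<^sup>+z. ennreal (real (snd (snd z))) \<partial>return (\<mu>0 \<Otimes>\<^sub>M count_space UNIV) (q, z)
            \<partial>candidate_law n J p y \<sigma> q)"
      by (intro nn_integral_bind[OF f] measurable_prob_algebraD)
    also have "\<dots> = (\<integral>\<^sup>+u. ennreal (real (snd u)) \<partial>candidate_law n J p y \<sigma> q)"
      using q by (intro nn_integral_cong) (simp add: nn_integral_return[OF _ f] space_pair_measure)
    finally show "(\<integral>\<^sup>+z. ennreal (real (snd (snd z)))
        \<partial>(candidate_law n J p y \<sigma> q \<bind> (\<lambda>z. return (\<mu>0 \<Otimes>\<^sub>M count_space UNIV) (q, z)))) = ennreal (g q)"
      using cost[OF q] by simp
  qed
  also have "\<dots> = ennreal (\<integral>q. g q \<partial>\<mu>0)"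
    using g_nonneg by (intro nn_integral_eq_integral g_int AE_I2)
  finally have mean_R: "(\<integral>\<^sup>+z. ennreal (real (snd (snd z))) \<partial>R) = ennreal (\<integral>q. g q \<partial>\<mu>0)" .
  have g_int_nonneg: "0 \<le> (\<integral>q. g q \<partial>\<mu>0)"
    using g_nonneg by (intro integral_nonneg_AE AE_I2)
  have sampler: "posterior_sampler \<mu>0 n J p y \<sigma> \<gamma> = measure_pmf (poisson_pmf \<Lambda>) \<Otimes>\<^sub>M (\<Pi>\<^sub>M i\<in>UNIV. R)"
    by (simp add: posterior_sampler_def \<Lambda>_def R_def)
  have W: "ennreal (real (W_act x)) = (case x of (m, \<omega>) \<Rightarrow> \<Sum>i\<in>{1..m}. ennreal (real (snd (snd (\<omega> i)))))" for x
    by (cases x) (simp add: W_act_def sum_ennreal)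
  have "has_bochner_integral (posterior_sampler \<mu>0 n J p y \<sigma> \<gamma>) (\<lambda>\<omega>. real (W_act \<omega>)) (\<Lambda> * (\<integral>q. g q \<partial>\<mu>0))"
  proof (rule has_bochner_integral_nn_integral)
    have "(\<lambda>z. real (snd (snd z))) \<in> borel_measurable (\<mu>0 \<Otimes>\<^sub>M count_space (UNIV :: (bool \<times> nat) set))"
      by (rule measurable_compose[OF measurable_snd]) simp
    then have "(\<lambda>z. real (snd (snd z))) \<in> borel_measurable R"
      by (simp add: measurable_cong_sets[OF R_sets refl])
    then have [measurable]: "(\<lambda>\<omega>. real (snd (snd (\<omega> i)))) \<in> borel_measurable (\<Pi>\<^sub>M i\<in>(UNIV :: nat set). R)" for i
      by (rule measurable_compose[OF measurable_component_singleton[OF UNIV_I]])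
    have "(\<lambda>x. real (W_act x)) \<in> borel_measurable (count_space UNIV \<Otimes>\<^sub>M (\<Pi>\<^sub>M i\<in>(UNIV :: nat set). R))"
      by (rule measurable_pair_measure_countable1) (auto simp: W_act_def)
    then show "(\<lambda>\<omega>. real (W_act \<omega>)) \<in> borel_measurable (posterior_sampler \<mu>0 n J p y \<sigma> \<gamma>)"
      unfolding sampler
      by (simp add: measurable_cong_sets[OF sets_pair_measure_cong[OF sets_measure_pmf_count_space refl] refl])
    show "(\<integral>\<^sup>+\<omega>. ennreal (real (W_act \<omega>)) \<partial>posterior_sampler \<mu>0 n J p y \<sigma> \<gamma>) = ennreal (\<Lambda> * (\<integral>q. g q \<partial>\<mu>0))"
      unfolding sampler W nn_integral_poisson_iid_sum[OF R_prob f_R \<Lambda>] mean_R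
      using \<Lambda> g_int_nonneg by (simp add: ennreal_mult)
  qed (use \<Lambda> g_int_nonneg in auto)
  then have "integrable (posterior_sampler \<mu>0 n J p y \<sigma> \<gamma>) (\<lambda>\<omega>. real (W_act \<omega>)) \<and>
      (\<integral>\<omega>. real (W_act \<omega>) \<partial>posterior_sampler \<mu>0 n J p y \<sigma> \<gamma>) = \<Lambda> * (\<integral>q. g q \<partial>\<mu>0)"
    by (simp only: has_bochner_integral_iff)
  then show ?thesis
    unfolding \<Lambda>_def g_def expected_trials_def Let_def .
qed

end
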